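(* Let $G$ be a finite group, let $\mathcal{H}(G)$ be the set of all subgroups of $G$, and for $g\in G$ let $$c_G(g):=\sum_{\substack{H\leq G\\ g\in H}}\frac1{|H|},\qquad \widehat{c}_G(g):=\frac{c_G(g)}{|\mathcal{H}(G)|}.$$ Consider the following random experiment: (1) choose a subgroup $H\leq G$ uniformly at random from $\mathcal{H}(G)$; (2) conditional on $H$, choose an element $g\in H$ uniformly at random. Then the resulting probability distribution on $G$ is $$\mathbb{P}(g)=\widehat{c}_G(g)=\frac{c_G(g)}{|\mathcal{H}(G)|}\qquad(g\in G).$$ Consequently, if $\Gamma$ is a finite graph with $G\leq\mathrm{Aut}(\Gamma)$ and $$\widehat{F}_{\Gamma}(G;x,y):=\frac{1}{|\mathcal{H}(G)|}F_{\Gamma}(G;x,y),$$ then $$\widehat{F}_{\Gamma}(G;x,y)=\sum_{g\in G}\widehat{c}_G(g)\,P_{\Gamma/g}(x,y)=\mathbb{E}\left[P_{\Gamma/g}(x,y)\right],$$ where the expectation is over the random element $g$ produced by the experiment.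
   Context: Graphs are finite and undirected; loops are allowed and parallel edges are irrelevant (only adjacency matters). For a graph $\Lambda$, the bivariate chromatic polynomial $P_\Lambda(x,y)$ (Dohmen–Pönitz–Tittmann) is the unique polynomial in $x,y$ such that, for all integers $x\ge y\ge 0$, $P_\Lambda(x,y)$ is the number of maps $c:V(\Lambda)\to\{1,\dots,x\}$ such that for every edge $uv$ of $\Lambda$ (including loops, $u=v$) with $c(u)=c(v)$ one has $c(u)>y$. Thus colours $1,\dots,y$ are "proper", colours $y+1,\dots,x$ are "improper", and a vertex carrying a loop can only receive an improper colour. For $g\in G$, the quotient graph $\Gamma/g$ has as vertices the $\langle g\rangle$-orbits on $V(\Gamma)$; two distinct orbits are adjacent iff at least one edge of $\Gamma$ joins them, and an orbit carries a loop iff some edge of $\Gamma$ has both endpoints in that orbit. The multiorbital bivariate chromatic polynomial of $\Gamma$ relative to $G$ is $$F_\Gamma(G;x,y):=\sum_{H\le G}\frac1{|H|}\sum_{h\in H}P_{\Gamma/h}(x,y),$$ the outer sum being over all subgroups $H$ of $G$. Identities are identities of polynomials in $x,y$ with rational coefficients. *)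

theory Defs
  imports
    "HOL-Algebra.Generated_Groups"
    "HOL-Algebra.Group_Action"
    "HOL-Computational_Algebra.Polynomial"
    "HOL-Probability.Probability_Mass_Function"
    "Graph_Theory.Pair_Digraph"
begin

text \<open>
  A finite undirected graph, with loops allowed and parallel edges ignored, is a
  \<open>pair_pseudo_graph\<close>: a finite vertex set with a symmetric set of arcs on it. The edge
  \<open>uv\<close> is the pair of arcs \<open>(u, v)\<close>, \<open>(v, u)\<close>; a loop at \<open>u\<close> is the arc \<open>(u, u)\<close>.

  A polynomial in \<open>x, y\<close> is an element of $(\mathbb{Q}[x])[y]$: the coefficient of
  \<open>x ^ i * y ^ j\<close> in \<open>p\<close> is \<open>coeff (coeff p j) i\<close>.
\<close>

definition eval2 :: "rat poly poly \<Rightarrow> 'a::field_char_0 \<Rightarrow> 'a \<Rightarrow> 'a" where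
  "eval2 p x y = poly (poly (map_poly (map_poly of_rat) p) [:y:]) x"


section \<open>The bivariate chromatic polynomial\<close>

definition bivariate_colourings :: "'v pair_pre_digraph \<Rightarrow> nat \<Rightarrow> nat \<Rightarrow> ('v \<Rightarrow> nat) set" where
  "bivariate_colourings \<Lambda> x y =
     {c \<in> pverts \<Lambda> \<rightarrow>\<^sub>E {1..x}. \<forall>(u, v) \<in> parcs \<Lambda>. c u = c v \<longrightarrow> c u > y}"

definition is_bivariate_chromatic_poly :: "'v pair_pre_digraph \<Rightarrow> rat poly poly \<Rightarrow> bool" where
  "is_bivariate_chromatic_poly \<Lambda> p \<longleftrightarrow>
     (\<forall>x y :: nat. y \<le> x \<longrightarrow>
        eval2 p (of_nat x :: rat) (of_nat y) = of_nat (card (bivariate_colourings \<Lambda> x y)))"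

text \<open>Existence and uniqueness for finite graphs are \<open>ex1_bivariate_chromatic_poly\<close> below.\<close>

definition bivariate_chromatic_poly :: "'v pair_pre_digraph \<Rightarrow> rat poly poly" where
  "bivariate_chromatic_poly \<Lambda> = (THE p. is_bivariate_chromatic_poly \<Lambda> p)"

lemma eval2_rat: "eval2 p (x :: rat) y = poly (poly p [:y:]) x"
proof -
  have "map_poly (of_rat :: rat \<Rightarrow> rat) = id"
    by (rule ext, rule poly_eqI) (simp add: coeff_map_poly)
  then show ?thesis by (simp add: eval2_def)
qed

lemma bivariate_poly_eq_0:
  fixes p :: "rat poly poly"
  assumes "\<And>x y :: nat. y \<le> x \<Longrightarrow> poly (poly p [:of_nat y:]) (of_nat x) = 0"
  shows "p = 0"
proof (rule ccontr)
  assume "p \<noteq> 0"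
  have *: "poly p [:of_nat y:] = 0" for y :: nat
  proof (rule ccontr)
    assume "poly p [:of_nat y:] \<noteq> 0"
    then have "finite {x. poly (poly p [:of_nat y:]) x = 0}" by (rule poly_roots_finite)
    moreover have "of_nat ` {y..} \<subseteq> {x. poly (poly p [:of_nat y:]) x = 0}"
      using assms by auto
    ultimately have "finite ((of_nat :: nat \<Rightarrow> rat) ` {y..})" by (rule finite_subset[rotated])
    then show False by (subst (asm) finite_image_iff) (auto simp: inj_on_def infinite_Ici)
  qed
  from \<open>p \<noteq> 0\<close> have "finite {q. poly p q = 0}" by (rule poly_roots_finite)
  moreover have "range (\<lambda>y::nat. [:of_nat y:]) \<subseteq> {q. poly p q = 0}" using * by auto
  ultimately have "finite (range (\<lambda>y::nat. [:of_nat y :: rat:]))" by (rule finite_subset[rotated])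
  then show False by (subst (asm) finite_image_iff) (auto simp: inj_on_def)
qed

lemma card_constant_on_arcs:
  fixes V :: "'v set" and A :: "'v rel"
  assumes "finite V" "A \<subseteq> V \<times> V"
  obtains m n where "\<And>x y :: nat. y \<le> x \<Longrightarrow>
    card {c \<in> V \<rightarrow>\<^sub>E {1..x}. \<forall>(u, v) \<in> A. c u = c v \<and> c u \<le> y} = x ^ m * y ^ n"
proof -
  define R where "R = {(u, v) \<in> V \<times> V. (u, v) \<in> (A \<union> A\<inverse>)\<^sup>*}"
  have symA: "(v, u) \<in> (A \<union> A\<inverse>)\<^sup>*" if "(u, v) \<in> (A \<union> A\<inverse>)\<^sup>*" for u v
    using that by (metis converse_Un converse_converse rtrancl_converseI sup_commute)
  have eq: "equiv V R"
    by (rule equivI) (auto simp: R_def refl_on_def sym_def trans_def intro: symA)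
  define Q where "Q = V // R"
  define B where "B = {C \<in> Q. C \<inter> Field A \<noteq> {}}"
  have finQ: "finite Q" unfolding Q_def
    using assms(1) eq by (metis finite_quotient equiv_type)
  have cl: "R `` {v} \<in> Q" if "v \<in> V" for v using that by (auto simp: Q_def quotientI)
  have self: "v \<in> R `` {v}" if "v \<in> V" for v using that eq by (metis equiv_class_self)
  have AR: "R `` {u} = R `` {v}" if "(u, v) \<in> A" for u v
    using that assms(2) eq by (intro equiv_class_eq[OF eq]) (auto simp: R_def)
  have "card {c \<in> V \<rightarrow>\<^sub>E {1..x}. \<forall>(u, v) \<in> A. c u = c v \<and> c u \<le> y}
      = x ^ card (Q - B) * y ^ card B" if "y \<le> x" for x y :: nat
  proof -
    let ?N = "{c \<in> V \<rightarrow>\<^sub>E {1..x}. \<forall>(u, v) \<in> A. c u = c v \<and> c u \<le> y}"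
    let ?D = "PiE Q (\<lambda>C. if C \<in> B then {1..y} else {1..x})"
    let ?\<Phi> = "\<lambda>d. \<lambda>v\<in>V. d (R `` {v})"
    have const: "c u = c v" if "c \<in> ?N" "(u, v) \<in> R" for c u v
    proof -
      have "(u, v) \<in> (A \<union> A\<inverse>)\<^sup>*" using that(2) by (simp add: R_def)
      then show ?thesis
        by (induction rule: rtrancl_induct) (use that(1) in auto)
    qed
    have "bij_betw ?\<Phi> ?D ?N"
      unfolding bij_betw_def
    proof (intro conjI inj_onI subset_antisym subsetI)
      fix d d' assume d: "d \<in> ?D" "d' \<in> ?D" and e: "?\<Phi> d = ?\<Phi> d'"
      show "d = d'"
      proof (rule PiE_ext[OF d])
        fix C assume "C \<in> Q"
        then obtain v where "v \<in> V" "C = R `` {v}" unfolding Q_def by (rule quotientE)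
        then show "d C = d' C" using fun_cong[OF e, of v] by simp
      qed
    next
      fix c assume "c \<in> ?\<Phi> ` ?D"
      then obtain d where d: "d \<in> ?D" and c: "c = ?\<Phi> d" by blast
      have dx: "d C \<in> {1..x}" if "C \<in> Q" for C
        using PiE_mem[OF d that] \<open>y \<le> x\<close> by (auto split: if_splits)
      have "c u = c v \<and> c u \<le> y" if "(u, v) \<in> A" for u v
      proof -
        have uv: "u \<in> V" "v \<in> V" using that assms(2) by auto
        have "R `` {u} \<in> B"
          using cl[OF uv(1)] self[OF uv(1)] that by (auto simp: B_def Field_def)
        then have "d (R `` {u}) \<le> y" using PiE_mem[OF d cl[OF uv(1)]] by simp
        then show ?thesis using uv AR[OF that] by (simp add: c)
      qed
      moreover have "c \<in> V \<rightarrow>\<^sub>E {1..x}"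
        unfolding c using dx cl by (intro restrict_PiE_iff[THEN iffD2]) blast
      ultimately show "c \<in> ?N" by blast
    next
      fix c assume c: "c \<in> ?N"
      define d where "d = (\<lambda>C\<in>Q. c (SOME v. v \<in> C))"
      have dR: "d (R `` {v}) = c v" if "v \<in> V" for v
      proof -
        have "(SOME w. w \<in> R `` {v}) \<in> R `` {v}" using self[OF that] by (rule someI)
        then have "c v = c (SOME w. w \<in> R `` {v})" by (intro const[OF c]) simp
        then show ?thesis using cl[OF that] by (simp add: d_def)
      qed
      have "d C \<in> (if C \<in> B then {1..y} else {1..x})" if "C \<in> Q" for C
      proof -
        obtain v where v: "v \<in> V" "C = R `` {v}" using \<open>C \<in> Q\<close> unfolding Q_def by (rule quotientE)
        have "c v \<le> y" if C: "C \<in> B"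
        proof -
          obtain w where w: "w \<in> C" "w \<in> Field A" using C unfolding B_def by blast
          from w(2) obtain a b where ab: "(a, b) \<in> A" "w = a \<or> w = b"
            by (auto simp: Field_def)
          have "c a = c b \<and> c a \<le> y" using c ab(1) by blast
          then have "c w \<le> y" using ab(2) by auto
          moreover have "(v, w) \<in> R" using w(1) v(2) by simp
          then have "c v = c w" by (rule const[OF c])
          ultimately show ?thesis by simp
        qed
        moreover have "c v \<in> {1..x}" using c v(1) by blast
        moreover have "d C = c v" using dR[OF v(1)] v(2) by simp
        ultimately show ?thesis by simp
      qed
      then have "d \<in> ?D" by (intro PiE_I) (auto simp: d_def)
      moreover have "c = ?\<Phi> d"
      proof
        fix v
        have "c v = undefined" if "v \<notin> V" using c that by (auto simp: PiE_def extensional_def)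
        then show "c v = ?\<Phi> d v" using dR[of v] by simp
      qed
      ultimately show "c \<in> ?\<Phi> ` ?D" by blast
    qed
    then have "card ?N = card ?D" by (simp add: bij_betw_same_card)
    also have "\<dots> = (\<Prod>C\<in>Q. if C \<in> B then y else x)"
      unfolding card_PiE[OF finQ] by (intro prod.cong) auto
    also have "\<dots> = (\<Prod>C\<in>Q \<inter> B. y) * (\<Prod>C\<in>Q - B. x)"
      unfolding prod.If_cases[OF finQ] by (simp add: Diff_eq Collect_neg_eq)
    also have "Q \<inter> B = B" by (auto simp: B_def)
    finally show ?thesis by simp
  qed
  then show thesis by (rule that)
qed

theorem ex1_bivariate_chromatic_poly:
  assumes "pair_fin_digraph \<Lambda>"
  shows "\<exists>!p. is_bivariate_chromatic_poly \<Lambda> p"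
proof -
  interpret pair_fin_digraph \<Lambda> by fact
  define V E where "V = pverts \<Lambda>" and "E = parcs \<Lambda>"
  have fin: "finite V" "finite E" and EV: "E \<subseteq> V \<times> V"
    using pair_finite_verts pair_finite_arcs by (auto simp: V_def E_def dest: in_arcsD1 in_arcsD2)
  define N where "N A x y = {c \<in> V \<rightarrow>\<^sub>E {1..x}. \<forall>(u, v) \<in> A. c u = c v \<and> c u \<le> y}"
    for A and x y :: nat
  have "\<exists>m n. \<forall>x y. y \<le> x \<longrightarrow> card (N A x y) = x ^ m * y ^ n" if "A \<subseteq> E" for A
  proof -
    have "A \<subseteq> V \<times> V" using that EV by (rule subset_trans)
    then obtain k l where "\<And>x y :: nat. y \<le> x \<Longrightarrow> card (N A x y) = x ^ k * y ^ l"
      unfolding N_def by (rule card_constant_on_arcs[OF fin(1)]) blast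
    then show ?thesis by blast
  qed
  then obtain m n where mn: "\<And>A x y. A \<subseteq> E \<Longrightarrow> y \<le> x \<Longrightarrow> card (N A x y) = x ^ m A * y ^ n A"
    by metis
  define p :: "rat poly poly" where
    "p = (\<Sum>A\<in>Pow E. monom (monom ((-1) ^ card A) (m A)) (n A))"
  have "is_bivariate_chromatic_poly \<Lambda> p"
    unfolding is_bivariate_chromatic_poly_def
  proof (intro allI impI)
    fix x y :: nat assume yx: "y \<le> x"
    let ?b = "\<lambda>c e. of_bool (c (fst e) = c (snd e) \<and> c (fst e) \<le> y) :: rat"
    have finC: "finite (V \<rightarrow>\<^sub>E {1..x})" using fin by (simp add: finite_PiE)
    have prodb: "(\<Prod>e\<in>A. ?b c e) = of_bool (\<forall>(u, v)\<in>A. c u = c v \<and> c u \<le> y)"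
      if "A \<subseteq> E" for A and c :: "'a \<Rightarrow> nat"
      using finite_subset[OF that fin(2)] by (induction A) auto
    have proper: "(\<Prod>e\<in>A. 1 - ?b c e) = of_bool (\<forall>(u, v)\<in>A. c u = c v \<longrightarrow> c u > y)"
      if "A \<subseteq> E" for A and c :: "'a \<Rightarrow> nat"
      using finite_subset[OF that fin(2)] by (induction A) auto
    have "of_nat (card (bivariate_colourings \<Lambda> x y))
        = (\<Sum>c\<in>V \<rightarrow>\<^sub>E {1..x}. of_bool (\<forall>(u, v)\<in>E. c u = c v \<longrightarrow> c u > y) :: rat)"
      using finC by (simp add: bivariate_colourings_def V_def E_def Int_def)
    also have "\<dots> = (\<Sum>c\<in>V \<rightarrow>\<^sub>E {1..x}. \<Prod>e\<in>E. - ?b c e + 1)"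
      unfolding proper[OF subset_refl, symmetric] by (intro sum.cong prod.cong refl) (rule diff_conv_add_uminus[THEN trans], rule add.commute)
    also have "\<dots> = (\<Sum>c\<in>V \<rightarrow>\<^sub>E {1..x}. \<Sum>A\<in>Pow E. (-1) ^ card A * (\<Prod>e\<in>A. ?b c e))"
      by (subst prod_add[OF fin(2)]) (simp add: prod_uminus)
    also have "\<dots> = (\<Sum>A\<in>Pow E. \<Sum>c\<in>V \<rightarrow>\<^sub>E {1..x}. (-1) ^ card A * (\<Prod>e\<in>A. ?b c e))"
      by (rule sum.swap)
    also have "\<dots> = (\<Sum>A\<in>Pow E. (-1) ^ card A * of_nat (card (N A x y)))"
      using finC
      by (intro sum.cong refl) (simp add: prodb N_def Int_def flip: sum_distrib_left)
    also have "\<dots> = (\<Sum>A\<in>Pow E. (-1) ^ card A * (of_nat x ^ m A * of_nat y ^ n A))"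
      using mn yx by (intro sum.cong refl) simp
    also have "\<dots> = poly (poly p [:of_nat y:]) (of_nat x)"
      by (simp add: p_def poly_sum poly_monom poly_const_pow algebra_simps)
    finally show "eval2 p (of_nat x :: rat) (of_nat y) = of_nat (card (bivariate_colourings \<Lambda> x y))"
      by (simp add: eval2_rat)
  qed
  moreover have "q = p" if "is_bivariate_chromatic_poly \<Lambda> q" "is_bivariate_chromatic_poly \<Lambda> p" for p q
    using bivariate_poly_eq_0[of "q - p"] that
    by (simp add: is_bivariate_chromatic_poly_def eval2_rat)
  ultimately show ?thesis by blast
qed


section \<open>Automorphisms and quotient graphs\<close>

text \<open>As in \<open>BijGroup\<close>, automorphisms are extensional functions on the vertex set.\<close>

definition aut_group :: "'v pair_pre_digraph \<Rightarrow> ('v \<Rightarrow> 'v) monoid" where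
  "aut_group \<Gamma> = (BijGroup (pverts \<Gamma>))
     \<lparr>carrier := {f \<in> Bij (pverts \<Gamma>). \<forall>u \<in> pverts \<Gamma>. \<forall>v \<in> pverts \<Gamma>.
                    (u, v) \<in> parcs \<Gamma> \<longleftrightarrow> (f u, f v) \<in> parcs \<Gamma>}\<rparr>"

text \<open>
  Here the elements of \<open>G\<close> are themselves permutations of the vertices, so the action is
  \<open>\<lambda>f. f\<close>. The case \<open>C = D\<close> of the arc condition gives the loops.
\<close>

definition quotient_graph ::
    "'v pair_pre_digraph \<Rightarrow> ('v \<Rightarrow> 'v, 'm) monoid_scheme \<Rightarrow> ('v \<Rightarrow> 'v) \<Rightarrow> 'v set pair_pre_digraph" where
  "quotient_graph \<Gamma> G g =
     (let orbs = orbits (G\<lparr>carrier := generate G {g}\<rparr>) (pverts \<Gamma>) (\<lambda>f. f)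
      in \<lparr>pverts = orbs,
          parcs = {(C, D) \<in> orbs \<times> orbs. \<exists>u \<in> C. \<exists>v \<in> D. (u, v) \<in> parcs \<Gamma>}\<rparr>)"


section \<open>The multiorbital polynomial and the random experiment\<close>

definition subgroups_of :: "('g, 'm) monoid_scheme \<Rightarrow> 'g set set" where
  "subgroups_of G = {H. subgroup H G}"

definition multiorbital_poly ::
    "'v pair_pre_digraph \<Rightarrow> ('v \<Rightarrow> 'v, 'm) monoid_scheme \<Rightarrow> rat poly poly" where
  "multiorbital_poly \<Gamma> G =
     (\<Sum>H\<in>subgroups_of G. smult [:1 / of_nat (card H):]
        (\<Sum>h\<in>H. bivariate_chromatic_poly (quotient_graph \<Gamma> G h)))"

definition normalized_multiorbital_poly ::
    "'v pair_pre_digraph \<Rightarrow> ('v \<Rightarrow> 'v, 'm) monoid_scheme \<Rightarrow> rat poly poly" where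
  "normalized_multiorbital_poly \<Gamma> G =
     smult [:1 / of_nat (card (subgroups_of G)):] (multiorbital_poly \<Gamma> G)"

definition subgroup_weight :: "('g, 'm) monoid_scheme \<Rightarrow> 'g \<Rightarrow> rat" where
  "subgroup_weight G g = (\<Sum>H | H \<in> subgroups_of G \<and> g \<in> H. 1 / of_nat (card H))"

definition normalized_subgroup_weight :: "('g, 'm) monoid_scheme \<Rightarrow> 'g \<Rightarrow> rat" where
  "normalized_subgroup_weight G g = subgroup_weight G g / of_nat (card (subgroups_of G))"

definition random_subgroup_element :: "('g, 'm) monoid_scheme \<Rightarrow> 'g pmf" where
  "random_subgroup_element G = bind_pmf (pmf_of_set (subgroups_of G)) pmf_of_set"

end

theory Submission
  imports Defs
begin

text \<open>
  The whole statement is an exchange of a double sum. Both the random experiment and the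
  multiorbital polynomial run over pairs \<open>(H, h)\<close> with \<open>H\<close> a subgroup and \<open>h \<in> H\<close>, each pair
  carrying the weight \<open>1 / |H|\<close>, up to a global factor of one over the number of subgroups.
  Collecting the pairs with the same second component \<open>g\<close> leaves exactly the sum
  \<open>subgroup_weight G g\<close> over the subgroups that contain \<open>g\<close>
  (lemmas \<open>pmf_random_subgroup_element\<close> and \<open>sum_over_subgroups_eq_weighted_sum\<close>).

  The distribution lives on a finite group, so every expectation is a finite sum weighted
  by \<open>normalized_subgroup_weight\<close>, and any additive functional of polynomials that respects
  rational scalars (extracting a coefficient, or evaluating at a real point) turns the
  polynomial identity into an expectation. What remains is that a group of automorphisms of a
  finite graph is a finite group.
\<close>

section \<open>The distribution of the random element\<close>

lemma finite_subgroups_of: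
  assumes "finite (carrier G)"
  shows "finite (subgroups_of G)"
proof (rule finite_subset)
  show "subgroups_of G \<subseteq> Pow (carrier G)"
    using subgroup.subset by (fastforce simp: subgroups_of_def)
  show "finite (Pow (carrier G))" using assms by simp
qed

context group
begin

lemma subgroups_of_nonempty: "subgroups_of G \<noteq> {}"
  using subgroup_self by (auto simp: subgroups_of_def)

lemma pmf_random_subgroup_element:
  assumes fin: "finite (carrier G)"
  shows "pmf (random_subgroup_element G) g = of_rat (normalized_subgroup_weight G g)"
proof -
  let ?S = "subgroups_of G"
  have finS: "finite ?S" by (rule finite_subgroups_of[OF fin])
  have pmf_H: "pmf (pmf_of_set H) g = of_bool (g \<in> H) / card H" if "H \<in> ?S" for H
  proof -
    have H: "subgroup H G" using that by (simp add: subgroups_of_def)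
    then have "finite H" using subgroup.subset fin finite_subset by blast
    moreover have "H \<noteq> {}" using subgroup.one_closed[OF H] by auto
    ultimately show ?thesis by (simp add: indicator_def)
  qed
  have "pmf (random_subgroup_element G) g = (\<Sum>H\<in>?S. pmf (pmf_of_set H) g) / card ?S"
    unfolding random_subgroup_element_def pmf_bind
    by (rule integral_pmf_of_set[OF subgroups_of_nonempty finS])
  also have "(\<Sum>H\<in>?S. pmf (pmf_of_set H) g) = (\<Sum>H\<in>?S. of_bool (g \<in> H) / card H)"
    using pmf_H by (intro sum.cong) auto
  also have "\<dots> = (\<Sum>H | H \<in> ?S \<and> g \<in> H. 1 / card H)"
    using finS by (intro sum.mono_neutral_cong_right) auto
  finally show ?thesis
    by (simp add: normalized_subgroup_weight_def subgroup_weight_def of_rat_divide of_rat_sum)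
qed

lemma expectation_random_subgroup_element:
  fixes f :: "'a \<Rightarrow> real"
  assumes fin: "finite (carrier G)"
  shows "measure_pmf.expectation (random_subgroup_element G) f =
    (\<Sum>g\<in>carrier G. of_rat (normalized_subgroup_weight G g) * f g)"
proof -
  \<comment> \<open>Outside the carrier no subgroup contributes, so the weight is an empty sum.\<close>
  have "normalized_subgroup_weight G g = 0" if "g \<notin> carrier G" for g
  proof -
    have "{H \<in> subgroups_of G. g \<in> H} = {}"
      using that by (auto simp: subgroups_of_def dest: subgroup.mem_carrier)
    then show ?thesis by (simp only: normalized_subgroup_weight_def subgroup_weight_def) simp
  qed
  then have "g \<in> carrier G" if "g \<in> set_pmf (random_subgroup_element G)" for g
    using that pmf_random_subgroup_element[OF fin, of g] by (auto simp: set_pmf_iff)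
  then show ?thesis
    using integral_measure_pmf[OF fin, of "random_subgroup_element G" f]
    by (simp add: pmf_random_subgroup_element[OF fin])
qed

end


section \<open>Collecting the pairs of a subgroup and an element of it\<close>

lemma smult_const_sum:
  fixes q :: "'a::comm_ring_1 poly poly"
  shows "(\<Sum>i\<in>I. smult [:w i:] q) = smult [:\<Sum>i\<in>I. w i:] q"
  by (induction I rule: infinite_finite_induct) (simp_all add: smult_add_left[symmetric])

lemma smult_sum_right:
  fixes f :: "'b \<Rightarrow> 'a::comm_ring_1 poly"
  shows "smult c (\<Sum>i\<in>I. f i) = (\<Sum>i\<in>I. smult c (f i))"
  by (induction I rule: infinite_finite_induct) (simp_all add: smult_add_right)

lemma sum_over_subgroups_eq_weighted_sum:
  fixes f :: "'g \<Rightarrow> rat poly poly"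
  assumes fin: "finite (carrier G)"
  shows "(\<Sum>H\<in>subgroups_of G. smult [:1 / of_nat (card H):] (\<Sum>h\<in>H. f h)) =
    (\<Sum>g\<in>carrier G. smult [:subgroup_weight G g:] (f g))"
proof -
  let ?S = "subgroups_of G"
  let ?t = "\<lambda>H g. smult [:1 / of_nat (card H):] (f g)"
  have "(\<Sum>H\<in>?S. smult [:1 / of_nat (card H):] (\<Sum>h\<in>H. f h)) =
      (\<Sum>H\<in>?S. \<Sum>g | g \<in> carrier G \<and> g \<in> H. ?t H g)"
  proof (rule sum.cong[OF refl])
    fix H assume "H \<in> ?S"
    then have "{g \<in> carrier G. g \<in> H} = H"
      by (auto simp: subgroups_of_def dest: subgroup.mem_carrier)
    then show "smult [:1 / of_nat (card H):] (\<Sum>h\<in>H. f h) =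
        (\<Sum>g | g \<in> carrier G \<and> g \<in> H. ?t H g)"
      by (simp add: smult_sum_right)
  qed
  also have "\<dots> = (\<Sum>g\<in>carrier G. \<Sum>H | H \<in> ?S \<and> g \<in> H. ?t H g)"
    by (rule sum.swap_restrict[OF finite_subgroups_of[OF fin] fin])
  also have "\<dots> = (\<Sum>g\<in>carrier G. smult [:subgroup_weight G g:] (f g))"
    by (simp only: smult_const_sum subgroup_weight_def)
  finally show ?thesis .
qed

lemma normalized_multiorbital_poly_eq_weighted_sum:
  assumes "finite (carrier K)"
  shows "normalized_multiorbital_poly \<Gamma> K =
    (\<Sum>g\<in>carrier K. smult [:normalized_subgroup_weight K g:]
      (bivariate_chromatic_poly (quotient_graph \<Gamma> K g)))"
  unfolding normalized_multiorbital_poly_def multiorbital_poly_def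
    sum_over_subgroups_eq_weighted_sum[OF assms]
  by (simp add: smult_sum_right normalized_subgroup_weight_def)


section \<open>Coefficients and values of bivariate polynomials\<close>

lemma eval2_0: "eval2 0 x y = 0"
  by (simp add: eval2_def)

lemma eval2_add: "eval2 (p + q) x y = eval2 p x y + eval2 q x y"
proof -
  have "map_poly (map_poly of_rat) (p + q) =
      (map_poly (map_poly of_rat) p + map_poly (map_poly of_rat) q :: 'a poly poly)"
    by (intro poly_eqI) (simp add: coeff_map_poly of_rat_add)
  then show ?thesis by (simp add: eval2_def)
qed

lemma eval2_smult_const: "eval2 (smult [:w:] p) x y = of_rat w * eval2 p x y"
proof -
  have "map_poly (map_poly of_rat) (smult [:w:] p) =
      (smult [:of_rat w:] (map_poly (map_poly of_rat) p) :: 'a poly poly)"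
    by (intro poly_eqI) (simp add: coeff_map_poly of_rat_mult)
  then show ?thesis by (simp add: eval2_def)
qed

text \<open>
  Coefficient extraction and evaluation at a real point are both instances of the functional
  \<open>L\<close>; this is the step that turns the weighted sum of polynomials into an expectation.
\<close>

lemma (in group) functional_weighted_sum_eq_expectation:
  fixes L :: "rat poly poly \<Rightarrow> real"
  assumes fin: "finite (carrier G)"
    and zero: "L 0 = 0"
    and add: "\<And>p q. L (p + q) = L p + L q"
    and scale: "\<And>w p. L (smult [:w:] p) = of_rat w * L p"
  shows "L (\<Sum>g\<in>carrier G. smult [:normalized_subgroup_weight G g:] (P g)) =
    measure_pmf.expectation (random_subgroup_element G) (\<lambda>g. L (P g))"
proof -
  have "L (\<Sum>g\<in>I. q g) = (\<Sum>g\<in>I. L (q g))" for I and q :: "'a \<Rightarrow> rat poly poly"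
    by (induction I rule: infinite_finite_induct) (simp_all add: zero add)
  then show ?thesis by (simp add: scale expectation_random_subgroup_element[OF fin])
qed


section \<open>Automorphism groups of finite graphs\<close>

lemma subgroup_aut_group_BijGroup:
  "subgroup (carrier (aut_group \<Gamma>)) (BijGroup (pverts \<Gamma>))"
proof -
  let ?V = "pverts \<Gamma>"
  interpret B: group "BijGroup ?V" by (rule group_BijGroup)
  show ?thesis
  proof (rule B.subgroupI)
    show "carrier (aut_group \<Gamma>) \<subseteq> carrier (BijGroup ?V)"
      by (auto simp: aut_group_def BijGroup_def)
    have "(\<lambda>v\<in>?V. v) \<in> carrier (aut_group \<Gamma>)"
      by (simp add: aut_group_def id_Bij)
    then show "carrier (aut_group \<Gamma>) \<noteq> {}" by blast
  next
    fix f assume f: "f \<in> carrier (aut_group \<Gamma>)"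
    then have fB: "f \<in> Bij ?V" by (simp add: aut_group_def)
    then have bij: "bij_betw f ?V ?V" by (simp add: Bij_def)
    let ?f' = "inv_into ?V f"
    have mem: "?f' v \<in> ?V" and right: "f (?f' v) = v" if "v \<in> ?V" for v
      using bij that by (auto simp: bij_betw_def inv_into_into f_inv_into_f)
    have "(u, v) \<in> parcs \<Gamma> \<longleftrightarrow> (?f' u, ?f' v) \<in> parcs \<Gamma>" if "u \<in> ?V" "v \<in> ?V" for u v
    proof -
      have "(?f' u, ?f' v) \<in> parcs \<Gamma> \<longleftrightarrow> (f (?f' u), f (?f' v)) \<in> parcs \<Gamma>"
        using f mem that by (simp add: aut_group_def)
      then show ?thesis using right that by simp
    qed
    then show "inv\<^bsub>BijGroup ?V\<^esub> f \<in> carrier (aut_group \<Gamma>)"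
      using restrict_inv_into_Bij[OF fB] by (simp add: inv_BijGroup[OF fB] aut_group_def)
  next
    fix f g assume fg: "f \<in> carrier (aut_group \<Gamma>)" "g \<in> carrier (aut_group \<Gamma>)"
    then have B: "f \<in> Bij ?V" "g \<in> Bij ?V" by (simp_all add: aut_group_def)
    have "g v \<in> ?V" if "v \<in> ?V" for v
      using Bij_imp_funcset[OF B(2)] that by auto
    then show "f \<otimes>\<^bsub>BijGroup ?V\<^esub> g \<in> carrier (aut_group \<Gamma>)"
      using fg B by (simp add: aut_group_def BijGroup_def compose_Bij compose_eq)
  qed
qed

lemma group_aut_group: "group (aut_group \<Gamma>)"
proof -
  have "aut_group \<Gamma> = (BijGroup (pverts \<Gamma>))\<lparr>carrier := carrier (aut_group \<Gamma>)\<rparr>"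
    by (simp add: aut_group_def)
  then show ?thesis
    using subgroup.subgroup_is_group[OF subgroup_aut_group_BijGroup group_BijGroup] by metis
qed

text \<open>
  Only finitely many automorphisms exist because they are extensional: each is determined by
  its values on the finite vertex set.
\<close>

lemma finite_carrier_aut_group:
  assumes "finite (pverts \<Gamma>)"
  shows "finite (carrier (aut_group \<Gamma>))"
proof (rule finite_subset)
  show "carrier (aut_group \<Gamma>) \<subseteq> pverts \<Gamma> \<rightarrow>\<^sub>E pverts \<Gamma>"
    by (auto simp: aut_group_def PiE_def Bij_imp_extensional dest: Bij_imp_funcset)
  show "finite (pverts \<Gamma> \<rightarrow>\<^sub>E pverts \<Gamma>)" using assms by (simp add: finite_PiE)
qed


section \<open>The normalized multiorbital polynomial as an expectation\<close>

theorem theorem3p11: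
  fixes G :: "('g, 'm) monoid_scheme"
    and \<Gamma> :: "'v pair_pre_digraph" and A :: "('v \<Rightarrow> 'v) set"
  shows
    "(group G \<and> finite (carrier G) \<longrightarrow>
        (\<forall>g\<in>carrier G.
           pmf (random_subgroup_element G) g = of_rat (normalized_subgroup_weight G g)))
   \<and> (pair_pseudo_graph \<Gamma> \<and> subgroup A (aut_group \<Gamma>) \<longrightarrow>
        (let K = (aut_group \<Gamma>)\<lparr>carrier := A\<rparr>;
             P = (\<lambda>g. bivariate_chromatic_poly (quotient_graph \<Gamma> K g));
             F = normalized_multiorbital_poly \<Gamma> K
         in F = (\<Sum>g\<in>A. smult [:normalized_subgroup_weight K g:] (P g))
          \<and> (\<forall>i j. real_of_rat (coeff (coeff F j) i) =
               measure_pmf.expectation (random_subgroup_element K)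
                 (\<lambda>g. real_of_rat (coeff (coeff (P g) j) i)))
          \<and> (\<forall>x y :: real. eval2 F x y =
               measure_pmf.expectation (random_subgroup_element K) (\<lambda>g. eval2 (P g) x y))))"
proof (intro conjI impI)
  assume "group G \<and> finite (carrier G)"
  then show "\<forall>g\<in>carrier G.
      pmf (random_subgroup_element G) g = of_rat (normalized_subgroup_weight G g)"
    by (simp add: group.pmf_random_subgroup_element)
next
  assume asm: "pair_pseudo_graph \<Gamma> \<and> subgroup A (aut_group \<Gamma>)"
  define K where "K = (aut_group \<Gamma>)\<lparr>carrier := A\<rparr>"
  define P where "P = (\<lambda>g. bivariate_chromatic_poly (quotient_graph \<Gamma> K g))"
  define F where "F = normalized_multiorbital_poly \<Gamma> K"
  interpret pair_pseudo_graph \<Gamma> using asm by simp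
  have carrier: "carrier K = A" by (simp add: K_def)
  interpret K: group K
    unfolding K_def using asm group_aut_group by (blast intro: subgroup.subgroup_is_group)
  have fin: "finite (carrier K)"
    using asm subgroup.subset finite_carrier_aut_group[OF pair_finite_verts] finite_subset
    unfolding carrier by blast
  have F: "F = (\<Sum>g\<in>carrier K. smult [:normalized_subgroup_weight K g:] (P g))"
    unfolding F_def P_def by (rule normalized_multiorbital_poly_eq_weighted_sum[OF fin])
  have "real_of_rat (coeff (coeff F j) i) =
      measure_pmf.expectation (random_subgroup_element K)
        (\<lambda>g. real_of_rat (coeff (coeff (P g) j) i))" for i j
    unfolding F
    by (rule K.functional_weighted_sum_eq_expectation[OF fin])
      (simp_all add: of_rat_add of_rat_mult)
  moreover have "eval2 F x y =
      measure_pmf.expectation (random_subgroup_element K) (\<lambda>g. eval2 (P g) x y)"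
    for x y :: real
    unfolding F
    by (rule K.functional_weighted_sum_eq_expectation[OF fin])
      (simp_all add: eval2_0 eval2_add eval2_smult_const)
  ultimately show "let K = (aut_group \<Gamma>)\<lparr>carrier := A\<rparr>;
             P = (\<lambda>g. bivariate_chromatic_poly (quotient_graph \<Gamma> K g));
             F = normalized_multiorbital_poly \<Gamma> K
         in F = (\<Sum>g\<in>A. smult [:normalized_subgroup_weight K g:] (P g))
          \<and> (\<forall>i j. real_of_rat (coeff (coeff F j) i) =
               measure_pmf.expectation (random_subgroup_element K)
                 (\<lambda>g. real_of_rat (coeff (coeff (P g) j) i)))
          \<and> (\<forall>x y :: real. eval2 F x y =
               measure_pmf.expectation (random_subgroup_element K) (\<lambda>g. eval2 (P g) x y))"
    using F[unfolded carrier] unfolding Let_def F_def P_def K_def by blast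
qed

end
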